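(* (1) Let $S=S_1+S_2\subseteq\mathbb{Z}^n$ be an $\mathrm{L}_2$-convex set, where $S_1,S_2\subseteq\mathbb{Z}^n$ are L-convex sets described for $k=1,2$ as $S_k=\{y\in\mathbb{Z}^n\mid y_j-y_i\le\gamma^{(k)}_{ij}\ ((i,j)\in E_k)\}$ with $E_k\subseteq (N\times N)\setminus\{(i,i)\mid i\in N\}$ and $\gamma^{(k)}_{ij}\in\mathbb{Z}$ for $(i,j)\in E_k$. Let $G_*$ be the associated directed graph. Then $$S=\{x\in\mathbb{Z}^n\mid x(\{j_1,\ldots,j_m\})-x(\{i_1,\ldots,i_m\})\le\gamma(C)\ \text{ for every simple mixed cycle } C \text{ in } G_*\},$$ where $(i_1,j_1,\ldots,i_m,j_m)$ denotes the break vertices of $C$ and $\gamma(C)$ its length. (2) Let $P=P_1+P_2\subseteq\mathbb{R}^n$ be an $\mathrm{L}_2$-convex polyhedron, where $P_1,P_2\subseteq\mathbb{R}^n$ are L-convex polyhedra described for $k=1,2$ as $P_k=\{y\in\mathbb{R}^n\mid y_j-y_i\le\gamma^{(k)}_{ij}\ ((i,j)\in E_k)\}$ with $E_k\subseteq (N\times N)\setminus\{(i,i)\mid i\in N\}$ and $\gamma^{(k)}_{ij}\in\mathbb{R}$ for $(i,j)\in E_k$. Let $G_*$ be the associated directed graph. Then $$P=\{x\in\mathbb{R}^n\mid x(\{j_1,\ldots,j_m\})-x(\{i_1,\ldots,i_m\})\le\gamma(C)\ \text{ for every simple mixed cycle } C \text{ in } G_*\},$$ where $(i_1,j_1,\ldots,i_m,j_m)$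 denotes the break vertices of $C$ and $\gamma(C)$ its length.
   Context: $N=\{1,\ldots,n\}$; for $x\in\mathbb{R}^n$ and $I\subseteq N$, $x(I)=\sum_{i\in I}x_i$; $x\vee y$, $x\wedge y$ are componentwise maximum and minimum; $\mathbf{1}=(1,\ldots,1)$. A nonempty set $S\subseteq\mathbb{Z}^n$ is L-convex if $x,y\in S$ implies $x\vee y,x\wedge y\in S$, and $x\in S,\mu\in\mathbb{Z}$ implies $x+\mu\mathbf{1}\in S$. A nonempty polyhedron $P\subseteq\mathbb{R}^n$ is L-convex if $x,y\in P$ implies $x\vee y,x\wedge y\in P$, and $x\in P,\mu\in\mathbb{R}$ implies $x+\mu\mathbf{1}\in P$. It is known that L-convex sets (resp. polyhedra) are exactly the nonempty sets describable by systems of the form $y_j-y_i\le\gamma_{ij}$ with integer (resp. real) $\gamma_{ij}$, as in the claim. No triangle inequality is imposed on $\gamma^{(k)}$. An $\mathrm{L}_2$-convex set (resp. polyhedron) is the Minkowski sum of two L-convex sets (resp. polyhedra). Graph: $G_*=(N,E_1\cup E_2^\circ)$ is the directed multigraph with vertex set $N$ whose edges are: for each $(i,j)\in E_1$, an edge $(i,j)_1$ from $i$ to $j$ of length $\gamma((i,j)_1)=\gamma^{(1)}_{ij}$ (these form the class $E_1$); and for each $(j,i)\in E_2$, an edge $(i,j)_2$ from $i$ to $j$ (the reversal of the edge in $E_2$) of length $\gamma((i,j)_2)=\gamma^{(2)}_{ji}$ (these form the class $E_2^\circ$). Edges of the two classes are considered distinct (parallel edges may occur). A cycle means a directed cycle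 $C=e_1e_2\cdots e_\ell$ (cyclic sequence of edges, the head of each edge being the tail of the next); its length is $\gamma(C)=\sum_{k=1}^{\ell}\gamma(e_k)$. It is simple if its vertices are all distinct, and mixed if it contains edges from both $E_1$ and $E_2^\circ$. For a mixed cycle $C$, cyclically rotate so that $e_1\in E_1$ and $e_\ell\in E_2^\circ$; then $C$ splits into maximal intervals of consecutive edges alternately in $E_1$ and $E_2^\circ$, with the same number $m\ge1$ of intervals of each class. The break vertices $(i_1,j_1,\ldots,i_m,j_m)$ of $C$ are defined so that the $r$-th $E_1$-interval starts at $i_r$ and ends at $j_r$, and the $r$-th $E_2^\circ$-interval starts at $j_r$ and ends at $i_{r+1}$ (with $i_{m+1}=i_1$), for $r=1,\ldots,m$. *)

theory Defs
  imports
    "HOL-Analysis.Analysis"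
    "HOL-Library.Set_Algebras"
    "Graph_Theory.Arc_Walk"
begin

text \<open>
  The ground set \<open>N\<close> is the type \<open>'n\<close>. The definitions are shared by the integral case
  (\<open>'a = int\<close>) and the real case (\<open>'a = real\<close>); the componentwise lattice operations are defined
  here because the library orders \<open>'a ^ 'n\<close> as a lattice only for Euclidean \<open>'a\<close>.
\<close>

definition vec_max :: "'a::linorder ^ 'n \<Rightarrow> 'a ^ 'n \<Rightarrow> 'a ^ 'n" where
  "vec_max x y = (\<chi> i. max (x $ i) (y $ i))"

definition vec_min :: "'a::linorder ^ 'n \<Rightarrow> 'a ^ 'n \<Rightarrow> 'a ^ 'n" where
  "vec_min x y = (\<chi> i. min (x $ i) (y $ i))"

definition L_convex :: "('a::linordered_idom ^ 'n) set \<Rightarrow> bool" where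
  "L_convex S \<longleftrightarrow>
     S \<noteq> {} \<and>
     (\<forall>x\<in>S. \<forall>y\<in>S. vec_max x y \<in> S \<and> vec_min x y \<in> S) \<and>
     (\<forall>x\<in>S. \<forall>\<mu>. x + \<mu> *s 1 \<in> S)"

definition L_convex_polyhedron :: "(real ^ 'n) set \<Rightarrow> bool" where
  "L_convex_polyhedron P \<longleftrightarrow> polyhedron P \<and> L_convex P"

text \<open>Addition of sets is the Minkowski sum.\<close>

definition L2_convex :: "(int ^ 'n) set \<Rightarrow> bool" where
  "L2_convex S \<longleftrightarrow> (\<exists>S1 S2. L_convex S1 \<and> L_convex S2 \<and> S = S1 + S2)"

definition L2_convex_polyhedron :: "(real ^ 'n) set \<Rightarrow> bool" where
  "L2_convex_polyhedron P \<longleftrightarrow>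
     (\<exists>P1 P2. L_convex_polyhedron P1 \<and> L_convex_polyhedron P2 \<and> P = P1 + P2)"

text \<open>
  \<open>Edge1 i j\<close> and \<open>Edge2 i j\<close> are the edges \<open>(i,j)\<^sub>1\<close> and \<open>(i,j)\<^sub>2\<close> of the multigraph, both directed
  from \<open>i\<close> to \<open>j\<close>; the latter comes from the pair \<open>(j,i)\<close> of the second system.
\<close>

datatype 'n edge =
    is_Edge1: Edge1 (edge_tail: 'n) (edge_head: 'n)
  | is_Edge2: Edge2 (edge_tail: 'n) (edge_head: 'n)

definition G_star :: "('n \<times> 'n) set \<Rightarrow> ('n \<times> 'n) set \<Rightarrow> ('n, 'n edge) pre_digraph" where
  "G_star E1 E2 =
     \<lparr>verts = UNIV,
      arcs = {Edge1 i j | i j. (i, j) \<in> E1} \<union> {Edge2 i j | i j. (j, i) \<in> E2},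
      tail = edge_tail,
      head = edge_head\<rparr>"

primrec edge_length :: "('n \<Rightarrow> 'n \<Rightarrow> 'a) \<Rightarrow> ('n \<Rightarrow> 'n \<Rightarrow> 'a) \<Rightarrow> 'n edge \<Rightarrow> 'a" where
  "edge_length \<gamma>1 \<gamma>2 (Edge1 i j) = \<gamma>1 i j"
| "edge_length \<gamma>1 \<gamma>2 (Edge2 i j) = \<gamma>2 j i"

definition cycle_length ::
    "('n \<Rightarrow> 'n \<Rightarrow> 'a::comm_monoid_add) \<Rightarrow> ('n \<Rightarrow> 'n \<Rightarrow> 'a) \<Rightarrow> 'n edge list \<Rightarrow> 'a" where
  "cycle_length \<gamma>1 \<gamma>2 C = (\<Sum>e\<leftarrow>C. edge_length \<gamma>1 \<gamma>2 e)"

definition mixed :: "'n edge list \<Rightarrow> bool" where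
  "mixed C \<longleftrightarrow> (\<exists>e\<in>set C. is_Edge1 e) \<and> (\<exists>e\<in>set C. is_Edge2 e)"

text \<open>
  \<^const>\<open>pre_digraph.cycle\<close> already requires the vertices of the directed cycle to be distinct.
\<close>

definition simple_mixed_cycle :: "('n \<times> 'n) set \<Rightarrow> ('n \<times> 'n) set \<Rightarrow> 'n edge list \<Rightarrow> bool" where
  "simple_mixed_cycle E1 E2 C \<longleftrightarrow> pre_digraph.cycle (G_star E1 E2) C \<and> mixed C"

text \<open>
  \<open>break_vertices C [(i\<^sub>1,j\<^sub>1), \<dots>, (i\<^sub>m,j\<^sub>m)]\<close>: some cyclic rotation of \<open>C\<close> is
  \<open>A\<^sub>1 @ B\<^sub>1 @ \<dots> @ A\<^sub>m @ B\<^sub>m\<close> with nonempty intervals \<open>A\<^sub>r\<close> of edges of the first and \<open>B\<^sub>r\<close> of edges of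
  the second class (the alternation makes them maximal), and \<open>A\<^sub>r\<close> leads from \<open>i\<^sub>r\<close> to \<open>j\<^sub>r\<close>. It is
  a relation because the list is determined only up to rotation.
\<close>

definition break_vertices :: "'n edge list \<Rightarrow> ('n \<times> 'n) list \<Rightarrow> bool" where
  "break_vertices C ps \<longleftrightarrow>
     (\<exists>k ABs. rotate k C = concat (map (\<lambda>(A, B). A @ B) ABs) \<and>
        (\<forall>(A, B)\<in>set ABs. A \<noteq> [] \<and> (\<forall>e\<in>set A. is_Edge1 e) \<and>
                           B \<noteq> [] \<and> (\<forall>e\<in>set B. is_Edge2 e)) \<and>
        ps = map (\<lambda>(A, B). (edge_tail (hd A), edge_head (last A))) ABs)"

lemma alternating_intervals_exist:
  assumes "es \<noteq> []" "is_Edge1 (hd es)" "is_Edge2 (last es)"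
  shows "\<exists>ABs. es = concat (map (\<lambda>(A, B). A @ B) ABs) \<and>
           (\<forall>(A, B)\<in>set ABs. A \<noteq> [] \<and> (\<forall>e\<in>set A. is_Edge1 e) \<and>
                              B \<noteq> [] \<and> (\<forall>e\<in>set B. is_Edge2 e))"
  using assms
proof (induction es rule: measure_induct_rule[of length])
  case (less es)
  define A where "A = takeWhile is_Edge1 es"
  define R where "R = dropWhile is_Edge1 es"
  define B where "B = takeWhile is_Edge2 R"
  define R' where "R' = dropWhile is_Edge2 R"
  have es: "es = A @ R" and R: "R = B @ R'"
    by (simp_all add: A_def R_def B_def R'_def)
  have A: "A \<noteq> []" "\<forall>e\<in>set A. is_Edge1 e"
    using less.prems(1,2) by (cases es; auto simp: A_def dest: set_takeWhileD)+
  have "R \<noteq> []"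
  proof
    assume "R = []"
    then have "is_Edge1 (last es)" using es A by simp
    then show False using less.prems(3) by (cases "last es") auto
  qed
  then have "is_Edge2 (hd R)"
    using hd_dropWhile[of is_Edge1 es] unfolding R_def
    by (cases "hd (dropWhile is_Edge1 es)") auto
  then have B: "B \<noteq> []" "\<forall>e\<in>set B. is_Edge2 e"
    using \<open>R \<noteq> []\<close> by (cases R; auto simp: B_def dest: set_takeWhileD)+
  show ?case
  proof (cases "R' = []")
    case True
    then show ?thesis using es R A B by (intro exI[of _ "[(A, B)]"]) auto
  next
    case False
    have "is_Edge1 (hd R')"
      using hd_dropWhile[of is_Edge2 R] False unfolding R'_def
      by (cases "hd (dropWhile is_Edge2 R)") auto
    moreover have "is_Edge2 (last R')" using less.prems(3) es R False by simp
    moreover have "length R' < length es" using es R A by simp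
    ultimately obtain ABs where "R' = concat (map (\<lambda>(A, B). A @ B) ABs)"
      "\<forall>(A, B)\<in>set ABs. A \<noteq> [] \<and> (\<forall>e\<in>set A. is_Edge1 e) \<and> B \<noteq> [] \<and> (\<forall>e\<in>set B. is_Edge2 e)"
      using less.IH[of R'] False by blast
    then show ?thesis using es R A B by (intro exI[of _ "(A, B) # ABs"]) auto
  qed
qed

lemma break_vertices_exist:
  assumes "mixed C"
  shows "\<exists>ps. break_vertices C ps"
proof -
  obtain xs e ys where C: "C = xs @ e # ys" and e: "is_Edge1 e"
    using assms unfolding mixed_def by (auto dest: split_list)
  define C' where "C' = rotate (length xs) C"
  have C': "C' = e # ys @ xs" unfolding C'_def C by (simp add: rotate_append)
  have "\<exists>f\<in>set C'. is_Edge2 f" using assms unfolding mixed_def C'_def by simp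
  then obtain us f vs where C'2: "C' = us @ f # vs" and f: "is_Edge2 f"
    and vs: "\<forall>v\<in>set vs. \<not> is_Edge2 v"
    using split_list_last_prop[of C' is_Edge2] by blast
  have us: "us \<noteq> []" "hd us = e"
  proof -
    have "e \<noteq> f" using e f by (cases e) auto
    moreover have "e # ys @ xs = us @ f # vs" using C' C'2 by simp
    ultimately show "us \<noteq> []" "hd us = e" by (cases us; simp)+
  qed
  have rot: "rotate (Suc (length us)) C' = vs @ us @ [f]"
    using rotate_append[of "us @ [f]" vs] by (simp add: C'2)
  have "is_Edge1 (hd (vs @ us @ [f]))"
  proof (cases vs)
    case (Cons v vs')
    then show ?thesis using vs by (cases v) auto
  qed (use us e in simp)
  then obtain ABs where ABs: "vs @ us @ [f] = concat (map (\<lambda>(A, B). A @ B) ABs)"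
    "\<forall>(A, B)\<in>set ABs. A \<noteq> [] \<and> (\<forall>e\<in>set A. is_Edge1 e) \<and> B \<noteq> [] \<and> (\<forall>e\<in>set B. is_Edge2 e)"
    using alternating_intervals_exist[of "vs @ us @ [f]"] f by auto
  have "rotate (Suc (length us) + length xs) C = vs @ us @ [f]"
    using rot by (simp only: C'_def rotate_rotate)
  then have "break_vertices C (map (\<lambda>(A, B). (edge_tail (hd A), edge_head (last A))) ABs)"
    unfolding break_vertices_def using ABs
    by (intro exI[of _ "Suc (length us) + length xs"] exI[of _ ABs] conjI)
       (simp_all only:)
  then show ?thesis ..
qed

end

theory Submission
  imports Defs
begin

text \<open>
  A point \<open>x\<close> lies in \<open>S1 + S2\<close> iff there is \<open>y \<in> S1\<close> with \<open>x - y \<in> S2\<close>. This says that \<open>y\<close> is a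
  feasible potential on \<open>G_star\<close>, where every edge \<open>e\<close> of the second class has its length modified
  by \<open>x(head e) - x(tail e)\<close>. Such a potential exists iff no simple cycle has negative modified
  length. On cycles that are not mixed this holds because \<open>S1\<close> and \<open>S2\<close> are nonempty. On a mixed
  cycle the differences \<open>x(head e) - x(tail e)\<close> sum to \<open>0\<close> over all edges, and they telescope on
  each interval of the first class, so the modified length is
  \<open>\<gamma>(C) - (x({j\<^sub>1, \<dots>, j\<^sub>m}) - x({i\<^sub>1, \<dots>, i\<^sub>m}))\<close>.
\<close>

section \<open>Potentials, walks and cycles in general digraphs\<close>

lemma (in pre_digraph) sum_list_potential_cas:
  fixes f :: "'a \<Rightarrow> 'c::ab_group_add"
  assumes "cas u p v"
  shows "(\<Sum>e\<leftarrow>p. f (head G e) - f (tail G e)) = f v - f u"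
  using assms by (induction p arbitrary: u) auto

lemma (in wf_digraph) cas_closed_rotate:
  assumes "cas u p u"
  obtains v where "cas v (rotate n p) v"
proof -
  define k where "k = n mod length p"
  define w where "w = awlast u (take k p)"
  have "cas u (take k p @ drop k p) u" using assms by simp
  then have tk: "cas u (take k p) w" and dr: "cas w (drop k p) u"
    unfolding cas_append_iff w_def by simp_all
  have "cas w (drop k p @ take k p) w"
    unfolding cas_append_iff awlast_if_cas[OF dr] using tk dr by simp
  then show thesis using that by (simp add: rotate_drop_take k_def)
qed

text \<open>The definition of \<open>cycle\<close> makes only the tail of the vertex list distinct,
  which is the list of heads. The vertex list is also the list of tails followed by the last head.
  As the cycle closes, tails and heads form the same multiset, so distinctness carries over to the
  tails.\<close>

lemma (in pre_digraph) cycle_distinct_ends: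
  assumes "cycle p"
  shows "distinct (map (tail G) p)" and "distinct (map (head G) p)"
proof -
  obtain u where cas: "cas u p u" and d: "distinct (tl (awalk_verts u p))" and p: "p \<noteq> []"
    using assms unfolding cycle_def awalk_def by blast
  have v: "awalk_verts u p = map (tail G) p @ [head G (last p)]"
    "awalk_verts u p = tail G (hd p) # map (head G) p"
    using awalk_verts_conv[of u p] awalk_verts_conv'[OF cas] p by simp_all
  show h: "distinct (map (head G) p)" using d v(2) by simp
  have "last (awalk_verts a q) = b" if "cas a q b" for a q b
    using that by (induction q arbitrary: a) auto
  note this[OF cas]
  moreover have "hd (awalk_verts u p) = u" using cas p by (cases p) auto
  ultimately have "head G (last p) = tail G (hd p)"
    using v by (metis last_snoc list.sel(1))
  moreover have "mset (map (tail G) p @ [head G (last p)]) = mset (tail G (hd p) # map (head G) p)"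
    using v by metis
  ultimately have "mset (map (tail G) p) = mset (map (head G) p)" by simp
  then show "distinct (map (tail G) p)" using h mset_eq_imp_distinct_iff by blast
qed

text \<open>The potential at v is the least length of a simple path ending at v, with arbitrary
  start, so no root reaching every vertex is required. Restricting to simple paths keeps the minimum
  over a finite set.\<close>

lemma (in fin_digraph) feasible_potential_exists:
  fixes l :: "'b \<Rightarrow> 'c::linordered_ab_group_add"
  assumes nonneg: "\<And>C. cycle C \<Longrightarrow> 0 \<le> (\<Sum>e\<leftarrow>C. l e)"
  obtains f where "\<And>e. e \<in> arcs G \<Longrightarrow> f (head G e) - f (tail G e) \<le> l e"
proof
  define L where "L p = (\<Sum>e\<leftarrow>p. l e)" for p
  define paths where "paths v = {p. \<exists>u. apath u p v}" for v
  define f where "f v = Min (L ` paths v)" for v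
  have fin: "finite (paths v)" for v
    by (rule finite_surj[OF apaths_finite_triple, of _ "fst \<circ> snd"]) (force simp: paths_def)
  have f_le: "f v \<le> L p" if "apath u p v" for u p v
    using that fin[of v] unfolding f_def by (intro Min_le) (auto simp: paths_def)
  fix e assume e: "e \<in> arcs G"
  \<comment> \<open>The empty path makes the set nonempty, so the minimum is attained by some
    p.\<close>
  have "[] \<in> paths (tail G e)" using e by (auto simp: paths_def apath_Nil_iff)
  then have "f (tail G e) \<in> L ` paths (tail G e)"
    unfolding f_def using fin by (intro Min_in) auto
  then obtain u p where p: "apath u p (tail G e)" and fp: "f (tail G e) = L p"
    by (auto simp: paths_def)
  have aw: "awalk u p (tail G e)" using p by (rule awalkI_apath)
  have "f (head G e) \<le> L p + l e"
  proof (cases "head G e \<in> set (awalk_verts u p)")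
    case False
    have "tail G e \<in> set (awalk_verts u p)"
      using aw last_in_set[OF awalk_verts_non_Nil, of u p] by auto
    then have "apath u (p @ [e]) (head G e)"
      unfolding apath_append_iff using p aw e False by (auto simp: apath_simps)
    from f_le[OF this] show ?thesis by (simp add: L_def)
  next
    case True
    \<comment> \<open>Here p already visits the head of e, so p followed by e is not simple. Its
      final portion r closes up with e to a cycle of nonnegative length; deleting that cycle leaves
      the simple path q, which is no longer.\<close>
    then obtain q r where pqr: "p = q @ r" and q: "awalk u q (head G e)"
      and r: "awalk (head G e) r (tail G e)"
      using awalk_decomp[OF aw] by blast
    have ap: "apath u q (head G e)" "apath (head G e) r (tail G e)"
      using p q unfolding pqr apath_append_iff by auto
    have "cycle (e # r)"
      unfolding cycle_def using r ap e
      by (intro exI[of _ "tail G e"]) (auto simp: awalk_Cons_iff apath_def)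
    from nonneg[OF this] have "L q \<le> L p + l e"
      by (simp add: L_def pqr algebra_simps)
    with f_le[OF ap(1)] show ?thesis by simp
  qed
  then show "f (head G e) - f (tail G e) \<le> l e"
    using fp by (simp add: algebra_simps)
qed

section \<open>The multigraph \<open>G_star\<close> and sums over break vertices\<close>

lemma G_star_simps [simp]:
  "verts (G_star E1 E2) = UNIV"
  "tail (G_star E1 E2) = edge_tail"
  "head (G_star E1 E2) = edge_head"
  "Edge1 i j \<in> arcs (G_star E1 E2) \<longleftrightarrow> (i, j) \<in> E1"
  "Edge2 i j \<in> arcs (G_star E1 E2) \<longleftrightarrow> (j, i) \<in> E2"
  by (auto simp: G_star_def)

lemma fin_digraph_G_star: "fin_digraph (G_star E1 (E2 :: ('n::finite \<times> 'n) set))"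
proof
  have "arcs (G_star E1 E2) \<subseteq> range (case_prod Edge1) \<union> range (case_prod Edge2)"
    by (auto simp: G_star_def)
  then show "finite (arcs (G_star E1 E2))" by (rule finite_subset) simp
qed simp_all

text \<open>Each A is a walk, so its differences telescope to the values at its two ends, while each
  B contributes 0.\<close>

lemma sum_Edge1_concat_intervals:
  fixes f :: "'n::finite \<Rightarrow> 'a::ab_group_add"
  assumes "pre_digraph.cas (G_star E1 E2) u (concat (map (\<lambda>(A, B). A @ B) ABs)) v"
    and "\<forall>(A, B)\<in>set ABs. A \<noteq> [] \<and> (\<forall>e\<in>set A. is_Edge1 e) \<and>
                           B \<noteq> [] \<and> (\<forall>e\<in>set B. is_Edge2 e)"
  shows "(\<Sum>e\<leftarrow>concat (map (\<lambda>(A, B). A @ B) ABs).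
            if is_Edge1 e then f (edge_head e) - f (edge_tail e) else 0) =
         (\<Sum>(A, B)\<leftarrow>ABs. f (edge_head (last A)) - f (edge_tail (hd A)))"
  using assms
proof (induction ABs arbitrary: u)
  case (Cons AB ABs)
  interpret fin_digraph "G_star E1 E2" by (rule fin_digraph_G_star)
  obtain A B where AB: "AB = (A, B)" by (cases AB)
  have A: "A \<noteq> []" "\<forall>e\<in>set A. is_Edge1 e" and B: "\<forall>e\<in>set B. is_Edge2 e"
    using Cons.prems(2) by (auto simp: AB)
  have "cas u A (awlast u A)"
    and rest: "cas (awlast (awlast u A) B) (concat (map (\<lambda>(A, B). A @ B) ABs)) v"
    using Cons.prems(1) by (simp_all add: AB)
  moreover have "awlast u A = edge_head (last A)" "u = edge_tail (hd A)"
    using A(1) \<open>cas u A (awlast u A)\<close> by (simp_all add: awalk_verts_conv cas_simp)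
  ultimately have "(\<Sum>e\<leftarrow>A. f (edge_head e) - f (edge_tail e)) =
      f (edge_head (last A)) - f (edge_tail (hd A))"
    using sum_list_potential_cas[of u A "awlast u A" f] by simp
  moreover have "(\<Sum>e\<leftarrow>A. if is_Edge1 e then f (edge_head e) - f (edge_tail e) else 0) =
      (\<Sum>e\<leftarrow>A. f (edge_head e) - f (edge_tail e))"
    using A(2) by (intro arg_cong[where f = sum_list] map_cong) auto
  moreover have "(\<Sum>e\<leftarrow>B. if is_Edge1 e then f (edge_head e) - f (edge_tail e) else 0) =
      (\<Sum>e\<leftarrow>B. 0)"
    using B by (intro arg_cong[where f = sum_list] map_cong) (auto simp: edge.disc_eq_case split: edge.splits)
  moreover note Cons.IH[OF rest] Cons.prems(2)
  ultimately show ?case by (simp add: AB)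
qed simp

text \<open>Used with \<open>hd\<close> and \<open>edge_tail\<close>, and with \<open>last\<close>
  and \<open>edge_head\<close>, to see that the i_r are pairwise distinct and so are the
  j_r.\<close>

lemma distinct_map_interval_elements:
  assumes "\<forall>(A, B)\<in>set ABs. h A \<in> set A"
    and "distinct (map g (concat (map (\<lambda>(A, B). A @ B) ABs)))"
  shows "distinct (map (\<lambda>(A, B). g (h A)) ABs)"
  using assms
proof (induction ABs)
  case (Cons AB ABs)
  obtain A B where AB: "AB = (A, B)" by (cases AB)
  have "(\<lambda>(A, B). g (h A)) ` set ABs \<subseteq> g ` set (concat (map (\<lambda>(A, B). A @ B) ABs))"
    using Cons.prems(1) by force
  moreover have "g (h A) \<notin> g ` set (concat (map (\<lambda>(A, B). A @ B) ABs))"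
  proof -
    have "g ` set A \<inter> g ` set (concat (map (\<lambda>(A, B). A @ B) ABs)) = {}"
      using Cons.prems(2) unfolding AB list.map concat.simps prod.case map_append
        distinct_append set_append set_map by blast
    moreover have "g (h A) \<in> g ` set A" using Cons.prems(1) by (simp add: AB)
    ultimately show ?thesis by blast
  qed
  ultimately have "g (h A) \<notin> (\<lambda>(A, B). g (h A)) ` set ABs" by blast
  then show ?case using Cons by (simp add: AB)
qed simp

text \<open>Around a closed walk all differences of f sum to 0, so the second class contributes the
  negative of what the first class contributes, and the latter telescopes interval by
  interval.\<close>

lemma sum_break_vertices:
  fixes f :: "'n::finite \<Rightarrow> 'a::ab_group_add"
  assumes C: "pre_digraph.cycle (G_star E1 E2) C" and ps: "break_vertices C ps"
  shows "(\<Sum>e\<leftarrow>C. if is_Edge2 e then f (edge_head e) - f (edge_tail e) else 0) =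
         (\<Sum>i\<in>fst ` set ps. f i) - (\<Sum>j\<in>snd ` set ps. f j)"
proof -
  interpret fin_digraph "G_star E1 E2" by (rule fin_digraph_G_star)
  define d1 where "d1 e = (if is_Edge1 e then f (edge_head e) - f (edge_tail e) else 0)" for e
  define d2 where "d2 e = (if is_Edge2 e then f (edge_head e) - f (edge_tail e) else 0)" for e
  obtain k ABs where rot: "rotate k C = concat (map (\<lambda>(A, B). A @ B) ABs)"
    and ABs: "\<forall>(A, B)\<in>set ABs. A \<noteq> [] \<and> (\<forall>e\<in>set A. is_Edge1 e) \<and>
                           B \<noteq> [] \<and> (\<forall>e\<in>set B. is_Edge2 e)"
    and ps_eq: "ps = map (\<lambda>(A, B). (edge_tail (hd A), edge_head (last A))) ABs"
    using ps unfolding break_vertices_def by blast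
  obtain u where u: "cas u C u" using C unfolding cycle_def by blast
  obtain v where v: "cas v (rotate k C) v" using cas_closed_rotate[OF u] .
  have "d1 e + d2 e = f (edge_head e) - f (edge_tail e)" for e
    by (cases e) (simp_all add: d1_def d2_def)
  then have total: "(\<Sum>e\<leftarrow>C. d1 e) + (\<Sum>e\<leftarrow>C. d2 e) = 0"
    using sum_list_potential_cas[OF u, of f] by (simp add: sum_list_addf[symmetric])
  \<comment> \<open>Without repetitions, the sums over the list \<open>ps\<close> agree with the
    sums over the sets of break vertices.\<close>
  have dist: "distinct (map snd ps)" "distinct (map fst ps)"
  proof -
    have ends: "\<forall>(A, B)\<in>set ABs. hd A \<in> set A" "\<forall>(A, B)\<in>set ABs. last A \<in> set A"
      using ABs by auto
    have "distinct (map edge_tail (rotate k C))" "distinct (map edge_head (rotate k C))"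
      using cycle_distinct_ends[OF C] by (simp_all add: rotate_map[symmetric])
    then show "distinct (map snd ps)" "distinct (map fst ps)"
      using ends[THEN distinct_map_interval_elements]
      unfolding rot ps_eq
      by (simp_all add: comp_def case_prod_unfold)
  qed
  have "(\<Sum>e\<leftarrow>C. d1 e) = (\<Sum>e\<leftarrow>rotate k C. d1 e)"
    unfolding rotate_drop_take
    by (metis add.commute append_take_drop_id map_append sum_list_append)
  also have "\<dots> = (\<Sum>(A, B)\<leftarrow>ABs. f (edge_head (last A)) - f (edge_tail (hd A)))"
    unfolding d1_def rot by (rule sum_Edge1_concat_intervals[OF v[unfolded rot] ABs])
  also have "\<dots> = (\<Sum>j\<leftarrow>map snd ps. f j) - (\<Sum>i\<leftarrow>map fst ps. f i)"
    by (simp add: ps_eq comp_def case_prod_unfold flip: sum_list_subtractf)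
  also have "\<dots> = (\<Sum>j\<in>snd ` set ps. f j) - (\<Sum>i\<in>fst ` set ps. f i)"
    using dist by (simp only: sum_list_distinct_conv_sum_set set_map)
  finally have "(\<Sum>e\<leftarrow>C. d1 e) = (\<Sum>j\<in>snd ` set ps. f j) - (\<Sum>i\<in>fst ` set ps. f i)" .
  moreover have "(\<Sum>e\<leftarrow>C. d2 e) = - (\<Sum>e\<leftarrow>C. d1 e)"
    using total by (simp add: eq_neg_iff_add_eq_0 add.commute)
  ultimately show ?thesis by (simp add: d2_def)
qed

section \<open>Modified lengths and the Minkowski sum\<close>

text \<open>For \<open>Edge2 i j\<close>, the constraint z_i - z_j \<le>
  \<open>\<gamma>2 j i\<close> on z = x - y reads y_j - y_i \<le> \<open>\<gamma>2 j i\<close> + x_j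
  - x_i. Thus both systems become upper bounds on y(head) - y(tail).\<close>

definition modified_length ::
    "('n \<Rightarrow> 'n \<Rightarrow> 'a::ab_group_add) \<Rightarrow> ('n \<Rightarrow> 'n \<Rightarrow> 'a) \<Rightarrow> 'a ^ 'n \<Rightarrow> 'n edge \<Rightarrow> 'a" where
  "modified_length \<gamma>1 \<gamma>2 x e =
     edge_length \<gamma>1 \<gamma>2 e + (if is_Edge2 e then x $ edge_head e - x $ edge_tail e else 0)"

lemma sum_modified_length_mixed:
  fixes x :: "'a::ab_group_add ^ 'n"
  assumes "pre_digraph.cycle (G_star E1 E2) C" and "break_vertices C ps"
  shows "(\<Sum>e\<leftarrow>C. modified_length \<gamma>1 \<gamma>2 x e) =
    cycle_length \<gamma>1 \<gamma>2 C - ((\<Sum>j\<in>snd ` set ps. x $ j) - (\<Sum>i\<in>fst ` set ps. x $ i))"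
  using sum_break_vertices[OF assms, of "\<lambda>i. x $ i"]
  by (simp add: modified_length_def cycle_length_def sum_list_addf)

lemma mem_sum_iff_potential:
  fixes x :: "'a::linordered_ab_group_add ^ 'n"
  shows "x \<in> {y. \<forall>(i, j)\<in>E1. y $ j - y $ i \<le> \<gamma>1 i j} + {y. \<forall>(i, j)\<in>E2. y $ j - y $ i \<le> \<gamma>2 i j} \<longleftrightarrow>
    (\<exists>f. \<forall>e\<in>arcs (G_star E1 E2). f (edge_head e) - f (edge_tail e) \<le> modified_length \<gamma>1 \<gamma>2 x e)"
    (is "x \<in> ?S1 + ?S2 \<longleftrightarrow> ?R")
proof
  assume "x \<in> ?S1 + ?S2"
  then obtain y z where yz: "x = y + z" "y \<in> ?S1" "z \<in> ?S2" by (auto elim: set_plus_elim)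
  have "y $ edge_head e - y $ edge_tail e \<le> modified_length \<gamma>1 \<gamma>2 x e"
    if "e \<in> arcs (G_star E1 E2)" for e
    using that yz by (cases e) (auto simp: modified_length_def algebra_simps)
  then show ?R by blast
next
  assume ?R
  then obtain f where f: "\<And>e. e \<in> arcs (G_star E1 E2) \<Longrightarrow>
    f (edge_head e) - f (edge_tail e) \<le> modified_length \<gamma>1 \<gamma>2 x e" by blast
  define y where "y = (\<chi> i. f i)"
  have "y \<in> ?S1"
    using f[of "Edge1 _ _"] by (auto simp: y_def modified_length_def)
  moreover have "x - y \<in> ?S2"
  proof (clarify)
    fix i j assume "(i, j) \<in> E2"
    then show "(x - y) $ j - (x - y) $ i \<le> \<gamma>2 i j"
      using f[of "Edge2 j i"] by (simp add: y_def modified_length_def algebra_simps)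
  qed
  ultimately have "y + (x - y) \<in> ?S1 + ?S2" by (rule set_plus_intro)
  then show "x \<in> ?S1 + ?S2" by simp
qed

text \<open>The differences of f sum to 0 around C. Feasibility is demanded only on the edges of C,
  so that a potential adapted to one class can serve for cycles inside that class.\<close>

lemma sum_modified_length_nonneg:
  fixes l :: "'n edge \<Rightarrow> 'a::linordered_ab_group_add"
  assumes C: "pre_digraph.cycle (G_star E1 E2) C"
    and f: "\<And>e. e \<in> set C \<Longrightarrow> e \<in> arcs (G_star E1 E2) \<Longrightarrow> f (edge_head e) - f (edge_tail e) \<le> l e"
  shows "0 \<le> (\<Sum>e\<leftarrow>C. l e)"
proof -
  interpret pre_digraph "G_star E1 E2" .
  obtain u where u: "cas u C u" and sub: "set C \<subseteq> arcs (G_star E1 E2)"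
    using C unfolding cycle_def awalk_def by blast
  have "0 = (\<Sum>e\<leftarrow>C. f (edge_head e) - f (edge_tail e))"
    using sum_list_potential_cas[OF u, of f] by simp
  also have "\<dots> \<le> (\<Sum>e\<leftarrow>C. l e)" using f sub by (intro sum_list_mono) auto
  finally show ?thesis .
qed

text \<open>The potential is built from sums and minima of modified lengths, hence has values in the
  same ordered group. This treats integers and reals at once, with integrality for free.\<close>

lemma sum_difference_systems:
  fixes \<gamma>1 \<gamma>2 :: "'n::finite \<Rightarrow> 'n \<Rightarrow> 'a::linordered_ab_group_add"
    and E1 E2 :: "('n \<times> 'n) set"
  defines "S1 \<equiv> {y :: 'a ^ 'n. \<forall>(i, j)\<in>E1. y $ j - y $ i \<le> \<gamma>1 i j}"
    and "S2 \<equiv> {y :: 'a ^ 'n. \<forall>(i, j)\<in>E2. y $ j - y $ i \<le> \<gamma>2 i j}"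
  assumes ne: "S1 \<noteq> {}" "S2 \<noteq> {}"
  shows "S1 + S2 =
    {x. \<forall>C ps. simple_mixed_cycle E1 E2 C \<and> break_vertices C ps \<longrightarrow>
          (\<Sum>j\<in>snd ` set ps. x $ j) - (\<Sum>i\<in>fst ` set ps. x $ i) \<le> cycle_length \<gamma>1 \<gamma>2 C}"
    (is "_ = ?R")
proof (intro set_eqI iffI)
  fix x assume "x \<in> S1 + S2"
  then obtain f where f: "\<And>e. e \<in> arcs (G_star E1 E2) \<Longrightarrow>
      f (edge_head e) - f (edge_tail e) \<le> modified_length \<gamma>1 \<gamma>2 x e"
    unfolding S1_def S2_def mem_sum_iff_potential by blast
  show "x \<in> ?R"
  proof (clarify)
    fix C ps assume C: "simple_mixed_cycle E1 E2 C" and ps: "break_vertices C ps"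
    have cyc: "pre_digraph.cycle (G_star E1 E2) C" using C by (simp add: simple_mixed_cycle_def)
    have "0 \<le> (\<Sum>e\<leftarrow>C. modified_length \<gamma>1 \<gamma>2 x e)"
      using sum_modified_length_nonneg[OF cyc, of f] f by blast
    then show "(\<Sum>j\<in>snd ` set ps. x $ j) - (\<Sum>i\<in>fst ` set ps. x $ i) \<le> cycle_length \<gamma>1 \<gamma>2 C"
      unfolding sum_modified_length_mixed[OF cyc ps] by simp
  qed
next
  fix x assume x: "x \<in> ?R"
  interpret fin_digraph "G_star E1 E2" by (rule fin_digraph_G_star)
  obtain y z where y: "y \<in> S1" and z: "z \<in> S2" using ne by blast
  have "0 \<le> (\<Sum>e\<leftarrow>C. modified_length \<gamma>1 \<gamma>2 x e)" if C: "cycle C" for C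
  proof -
    consider "mixed C" | "\<forall>e\<in>set C. is_Edge1 e" | "\<forall>e\<in>set C. is_Edge2 e"
      unfolding mixed_def by (metis edge.exhaust_disc)
    then show ?thesis
    proof cases
      case 1
      \<comment> \<open>The inequality is assumed for every list of break vertices of C, so any one
        of them will do.\<close>
      then obtain ps where ps: "break_vertices C ps" using break_vertices_exist by blast
      have "(\<Sum>j\<in>snd ` set ps. x $ j) - (\<Sum>i\<in>fst ` set ps. x $ i) \<le> cycle_length \<gamma>1 \<gamma>2 C"
        using x C 1 ps by (auto simp: simple_mixed_cycle_def)
      then show ?thesis unfolding sum_modified_length_mixed[OF C ps] by simp
    next
      case 2
      \<comment> \<open>Any point of \<open>S1\<close> is a feasible potential on first-class edges,
        whatever x is.\<close>
      have "y $ edge_head e - y $ edge_tail e \<le> modified_length \<gamma>1 \<gamma>2 x e"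
        if "e \<in> set C" "e \<in> arcs (G_star E1 E2)" for e
        using that 2 y by (cases e rule: edge.exhaust) (auto simp: modified_length_def S1_def)
      then show ?thesis by (rule sum_modified_length_nonneg[OF C])
    next
      case 3
      \<comment> \<open>On second-class edges the shift by x cancels, leaving the constraints that z
        satisfies as a point of \<open>S2\<close>.\<close>
      have "(x - z) $ edge_head e - (x - z) $ edge_tail e \<le> modified_length \<gamma>1 \<gamma>2 x e"
        if "e \<in> set C" "e \<in> arcs (G_star E1 E2)" for e
        using that 3 z by (cases e rule: edge.exhaust) (auto simp: modified_length_def S2_def algebra_simps)
      then show ?thesis by (rule sum_modified_length_nonneg[OF C])
    qed
  qed
  then obtain f where "\<And>e. e \<in> arcs (G_star E1 E2) \<Longrightarrow>
      f (edge_head e) - f (edge_tail e) \<le> modified_length \<gamma>1 \<gamma>2 x e"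
    using feasible_potential_exists[of "modified_length \<gamma>1 \<gamma>2 x"] by auto
  then show "x \<in> S1 + S2" unfolding S1_def S2_def mem_sum_iff_potential by blast
qed

theorem theorem4p1:
  shows
    "(\<forall>(S :: (int ^ 'n) set) S1 S2 (E1 :: ('n \<times> 'n) set) E2
        (\<gamma>1 :: 'n \<Rightarrow> 'n \<Rightarrow> int) (\<gamma>2 :: 'n \<Rightarrow> 'n \<Rightarrow> int).
        L2_convex S \<and> S = S1 + S2 \<and> L_convex S1 \<and> L_convex S2 \<and>
        E1 \<subseteq> (UNIV \<times> UNIV) - {(i, i) | i. i \<in> UNIV} \<and>
        E2 \<subseteq> (UNIV \<times> UNIV) - {(i, i) | i. i \<in> UNIV} \<and>
        S1 = {y. \<forall>(i, j)\<in>E1. y $ j - y $ i \<le> \<gamma>1 i j} \<and>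
        S2 = {y. \<forall>(i, j)\<in>E2. y $ j - y $ i \<le> \<gamma>2 i j} \<longrightarrow>
        S = {x. \<forall>C ps. simple_mixed_cycle E1 E2 C \<and> break_vertices C ps \<longrightarrow>
                  (\<Sum>j\<in>snd ` set ps. x $ j) - (\<Sum>i\<in>fst ` set ps. x $ i)
                    \<le> cycle_length \<gamma>1 \<gamma>2 C})
     \<and>
     (\<forall>(P :: (real ^ 'n) set) P1 P2 (E1 :: ('n \<times> 'n) set) E2
        (\<gamma>1 :: 'n \<Rightarrow> 'n \<Rightarrow> real) (\<gamma>2 :: 'n \<Rightarrow> 'n \<Rightarrow> real).
        L2_convex_polyhedron P \<and> P = P1 + P2 \<and>
        L_convex_polyhedron P1 \<and> L_convex_polyhedron P2 \<and>
        E1 \<subseteq> (UNIV \<times> UNIV) - {(i, i) | i. i \<in> UNIV} \<and>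
        E2 \<subseteq> (UNIV \<times> UNIV) - {(i, i) | i. i \<in> UNIV} \<and>
        P1 = {y. \<forall>(i, j)\<in>E1. y $ j - y $ i \<le> \<gamma>1 i j} \<and>
        P2 = {y. \<forall>(i, j)\<in>E2. y $ j - y $ i \<le> \<gamma>2 i j} \<longrightarrow>
        P = {x. \<forall>C ps. simple_mixed_cycle E1 E2 C \<and> break_vertices C ps \<longrightarrow>
                  (\<Sum>j\<in>snd ` set ps. x $ j) - (\<Sum>i\<in>fst ` set ps. x $ i)
                    \<le> cycle_length \<gamma>1 \<gamma>2 C})"
  \<comment> \<open>L-convexity of the summands supplies the two nonemptiness hypotheses.\<close>
  using sum_difference_systems[where 'a = int and 'n = 'n]
    sum_difference_systems[where 'a = real and 'n = 'n]
  by (intro conjI allI impI; elim conjE)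
    (simp_all add: L_convex_def L_convex_polyhedron_def)

end
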